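(* Let $G$ be a balanceable oriented hypergraph. Then $B$ is a minimal balancing set for $G$ if, and only if, $B$ is obtained by Camion's Incidence Reorientation Algorithm (that is, $B=B_T$ for some choice of spanning tree $T$ in the algorithm).
   Context: An oriented hypergraph is a quintuple $G=(V,E,I,\iota,\sigma)$ consisting of a set of vertices $V$, a set of edges $E$, a set of incidences $I$, an incidence function $\iota:I\to V\times E$, and an orientation function $\sigma:I\to\{+1,-1\}$. The bipartite representation graph $\Gamma$ of $G$ is the bipartite graph with vertex set $V\cup E$ and edge set $I$. A circle of $G$ is a closed path, i.e. a closed non-repeating alternating sequence of vertices and edges joined by incidences; circles of $G$ correspond to cycles of $\Gamma$. A circle with incidences $i_1,\dots,i_n$ has sign $(-1)^{\lfloor n/2\rfloor}\prod_{k=1}^n\sigma(i_k)$. $G$ is balanced if every circle is positive, and balanceable if there exists a balanced orientation of the same underlying structure $(V,E,I,\iota)$. A balancing set of $G$ is a set of incidences whose reversal (negating $\sigma$ on the set) turns $G$ into a balanced oriented hypergraph; it is minimal if no proper subset of it is a balancing set. Camion's Incidence Reorientation Algorithm: the input is an oriented hypergraph $G$ and its oriented bipartite representation graph $\Gamma$. Find a spanning tree $T$ of $\Gamma$. Assign the edges of $T$ (which are incidences of $G$) the signs of the orientation in $G$. For each $e\in\Gamma\setminus T$, assign $e$ the unique sign such that its fundamental circle with respect to $T$ is positive in $G$. The output is a balanced oriented hypergraph $G'$ if $G$ was balanceable, and the set $B_T$ of incidences whose signs changed.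
   Formalization: For disconnected Γ no spanning tree exists although minimal balancing sets do, so the claim fails literally; "spanning tree" is taken to mean a spanning forest (a spanning tree in each component of Γ), which is a spanning tree when Γ is connected. *)

theory Defs
  imports Main
begin

record ('v, 'e, 'i) ohgraph =
  verts :: "'v set"
  edges :: "'e set"
  incs :: "'i set"
  inc :: "'i \<Rightarrow> 'v \<times> 'e"
  orient :: "'i \<Rightarrow> int"

definition oriented_hypergraph :: "('v, 'e, 'i) ohgraph \<Rightarrow> bool" where
  "oriented_hypergraph G \<longleftrightarrow>
     inc G ` incs G \<subseteq> verts G \<times> edges G \<and> orient G ` incs G \<subseteq> {1, -1}"


text \<open>The bipartite representation graph: the node set is the disjoint union of
  vertices and edges, and every incidence is an edge of the graph. The map
  \<open>inc G\<close> need not be injective, so this is a multigraph.\<close>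

definition nodes :: "('v, 'e, 'i) ohgraph \<Rightarrow> ('v + 'e) set" where
  "nodes G = verts G <+> edges G"

definition ends :: "('v, 'e, 'i) ohgraph \<Rightarrow> 'i \<Rightarrow> ('v + 'e) set" where
  "ends G i = {Inl (fst (inc G i)), Inr (snd (inc G i))}"


text \<open>A circle is given by its cyclic sequence \<open>xs\<close> of vertices and edges and its cyclic
  sequence \<open>js\<close> of incidences, where \<open>js ! k\<close> joins \<open>xs ! k\<close> to its cyclic successor.
  Alternation of vertices and edges is forced by the form of \<open>ends\<close>. Two parallel
  incidences form a circle of length two, but a single incidence traversed back and
  forth does not.\<close>

definition circle :: "('v, 'e, 'i) ohgraph \<Rightarrow> ('v + 'e) list \<Rightarrow> 'i list \<Rightarrow> bool" where
  "circle G xs js \<longleftrightarrow>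
     js \<noteq> [] \<and> length xs = length js \<and> distinct xs \<and> distinct js \<and> set js \<subseteq> incs G \<and>
     (\<forall>k < length js. ends G (js ! k) = {xs ! k, xs ! (Suc k mod length xs)})"

definition circle_sign :: "('i \<Rightarrow> int) \<Rightarrow> 'i list \<Rightarrow> int" where
  "circle_sign s js = (-1) ^ (length js div 2) * prod_list (map s js)"

definition balanced :: "('v, 'e, 'i) ohgraph \<Rightarrow> bool" where
  "balanced G \<longleftrightarrow> (\<forall>xs js. circle G xs js \<longrightarrow> circle_sign (orient G) js = 1)"

definition balanceable :: "('v, 'e, 'i) ohgraph \<Rightarrow> bool" where
  "balanceable G \<longleftrightarrow> (\<exists>s. s ` incs G \<subseteq> {1, -1} \<and> balanced (G\<lparr>orient := s\<rparr>))"

definition reverse :: "('v, 'e, 'i) ohgraph \<Rightarrow> 'i set \<Rightarrow> ('v, 'e, 'i) ohgraph" where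
  "reverse G B = G\<lparr>orient := (\<lambda>i. if i \<in> B then - orient G i else orient G i)\<rparr>"

definition balancing_set :: "('v, 'e, 'i) ohgraph \<Rightarrow> 'i set \<Rightarrow> bool" where
  "balancing_set G B \<longleftrightarrow> B \<subseteq> incs G \<and> balanced (reverse G B)"

definition minimal_balancing_set :: "('v, 'e, 'i) ohgraph \<Rightarrow> 'i set \<Rightarrow> bool" where
  "minimal_balancing_set G B \<longleftrightarrow>
     balancing_set G B \<and> (\<forall>B'. B' \<subset> B \<longrightarrow> \<not> balancing_set G B')"


definition linked :: "('v, 'e, 'i) ohgraph \<Rightarrow> 'i set \<Rightarrow> ('v + 'e) \<Rightarrow> ('v + 'e) \<Rightarrow> bool" where
  "linked G T x y \<longleftrightarrow> (x, y) \<in> {(a, b). \<exists>i\<in>T. ends G i = {a, b}}\<^sup>*"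

definition connected_by :: "('v, 'e, 'i) ohgraph \<Rightarrow> 'i set \<Rightarrow> bool" where
  "connected_by G T \<longleftrightarrow> (\<forall>x\<in>nodes G. \<forall>y\<in>nodes G. linked G T x y)"

definition circle_free :: "('v, 'e, 'i) ohgraph \<Rightarrow> 'i set \<Rightarrow> bool" where
  "circle_free G T \<longleftrightarrow> \<not> (\<exists>xs js. circle G xs js \<and> set js \<subseteq> T)"

definition spanning_tree :: "('v, 'e, 'i) ohgraph \<Rightarrow> 'i set \<Rightarrow> bool" where
  "spanning_tree G T \<longleftrightarrow> T \<subseteq> incs G \<and> circle_free G T \<and> connected_by G T"

text \<open>A disconnected representation graph has no spanning tree in the literal sense. There,
  as usual, one chooses a spanning tree of each connected component; for a connected
  representation graph this is the same as a spanning tree.\<close>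

definition spanning_forest :: "('v, 'e, 'i) ohgraph \<Rightarrow> 'i set \<Rightarrow> bool" where
  "spanning_forest G T \<longleftrightarrow> T \<subseteq> incs G \<and> circle_free G T \<and>
     (\<forall>x\<in>nodes G. \<forall>y\<in>nodes G. linked G (incs G) x y \<longrightarrow> linked G T x y)"

lemma spanning_forest_iff_spanning_tree:
  assumes "connected_by G (incs G)"
  shows "spanning_forest G T \<longleftrightarrow> spanning_tree G T"
  using assms unfolding spanning_forest_def spanning_tree_def connected_by_def by blast


definition fundamental_circle ::
    "('v, 'e, 'i) ohgraph \<Rightarrow> 'i set \<Rightarrow> 'i \<Rightarrow> ('v + 'e) list \<Rightarrow> 'i list \<Rightarrow> bool" where
  "fundamental_circle G T i xs js \<longleftrightarrow> circle G xs js \<and> i \<in> set js \<and> set js \<subseteq> insert i T"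

text \<open>For a spanning forest \<open>T\<close> and an incidence \<open>i\<close> outside \<open>T\<close>, the fundamental circle
  is unique up to rotation and reversal of the two sequences, which do not affect its
  sign; so the description below picks out exactly one sign.\<close>

definition camion_orient :: "('v, 'e, 'i) ohgraph \<Rightarrow> 'i set \<Rightarrow> 'i \<Rightarrow> int" where
  "camion_orient G T i =
     (if i \<in> T then orient G i
      else (THE s. s \<in> {1, -1} \<and>
        (\<forall>xs js. fundamental_circle G T i xs js \<longrightarrow>
           circle_sign ((orient G)(i := s)) js = 1)))"

definition camion_set :: "('v, 'e, 'i) ohgraph \<Rightarrow> 'i set \<Rightarrow> 'i set" where
  "camion_set G T = {i \<in> incs G. camion_orient G T i \<noteq> orient G i}"

end

theory Submission
  imports Defs
begin

text \<open>Multiplying the sign of every incidence \<open>x y\<close> by \<open>p x * p y\<close>, for a \<open>\<plusminus>1\<close>-valued function \<open>p\<close>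
  on the nodes, preserves the sign of every circle, as each node of a circle is met twice.
  On a forest \<open>p\<close> can be chosen to
  produce any prescribed signs, so some balanced orientation agrees with \<open>G\<close> on a given
  spanning forest \<open>T\<close>; by the fundamental circles it is the only one, and hence \<open>camion_set G T\<close>
  is the only balancing set disjoint from \<open>T\<close>. This gives minimality. Conversely, a minimal
  balancing set contains no nonempty cut, as the cut could be removed from it; so its complement
  connects all that \<open>G\<close> connects and contains a spanning forest \<open>T\<close>.\<close>

section \<open>Walks in the representation graph\<close>

text \<open>Each step pairs an incidence with the node it leads to, since \<open>ends\<close> is
  unordered; the start stays outside the list, so walks concatenate by \<open>@\<close>. Nodes and
  incidences may repeat.\<close>

fun walk :: "('v, 'e, 'i) ohgraph \<Rightarrow> 'v + 'e \<Rightarrow> ('i \<times> ('v + 'e)) list \<Rightarrow> 'v + 'e \<Rightarrow> bool" where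
  "walk G x [] y \<longleftrightarrow> x = y"
| "walk G x ((i, z) # w) y \<longleftrightarrow> ends G i = {x, z} \<and> walk G z w y"

lemma walk_append: "walk G x (w @ w') y \<longleftrightarrow> (\<exists>z. walk G x w z \<and> walk G z w' y)"
  by (induction G x w y rule: walk.induct) auto

lemma walk_snoc: "walk G x (w @ [(i, z)]) y \<longleftrightarrow> z = y \<and> (\<exists>u. walk G x w u \<and> ends G i = {u, z})"
  by (auto simp: walk_append)

lemma walk_nth:
  assumes "walk G x w y" "k < length w"
  shows "ends G (fst (w ! k)) = {(x # map snd w) ! k, map snd w ! k}"
  using assms
proof (induction G x w y arbitrary: k rule: walk.induct)
  case (2 G x i z w y)
  then show ?case by (cases k) auto
qed auto

lemma walk_last:
  assumes "walk G x w y" "w \<noteq> []"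
  shows "last (map snd w) = y"
  using assms by (induction G x w y rule: walk.induct) (auto split: if_splits)

text \<open>The reversal is not \<open>rev w\<close>, because every incidence has to be paired with
  its other end; only the incidences and their product are recorded for later use.\<close>

lemma walk_rev:
  fixes c :: "'i \<Rightarrow> int"
  assumes "walk G x w y"
  obtains w' where "walk G y w' x" "fst ` set w' = fst ` set w"
    "prod_list (map (c \<circ> fst) w') = prod_list (map (c \<circ> fst) w)"
proof -
  have "\<exists>w'. walk G y w' x \<and> fst ` set w' = fst ` set w \<and>
      prod_list (map (c \<circ> fst) w') = prod_list (map (c \<circ> fst) w)"
    using assms
  proof (induction G x w y rule: walk.induct)
    case (1 G x y)
    then show ?case by (intro exI[of _ "[]"]) auto
  next
    case (2 G x i z w y)
    have "walk G z w y" using 2(2) by simp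
    then obtain w' where "walk G y w' z" "fst ` set w' = fst ` set w"
      "prod_list (map (c \<circ> fst) w') = prod_list (map (c \<circ> fst) w)"
      using 2(1) by blast
    with 2(2) show ?case
      by (intro exI[of _ "w' @ [(i, x)]"]) (auto simp: walk_snoc doubleton_eq_iff comp_def)
  qed
  with that show thesis by blast
qed

section \<open>Linkedness by sets of incidences\<close>

lemma linkedE_walk:
  assumes "linked G T x y"
  obtains w where "walk G x w y" "fst ` set w \<subseteq> T"
proof -
  have "(x, y) \<in> {(a, b). \<exists>i\<in>T. ends G i = {a, b}}\<^sup>*"
    using assms by (simp add: linked_def)
  then have "\<exists>w. walk G x w y \<and> fst ` set w \<subseteq> T"
  proof (induction rule: rtrancl_induct)
    case base
    show ?case by (intro exI[of _ "[]"]) auto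
  next
    case (step y z)
    then obtain w i where "walk G x w y" "fst ` set w \<subseteq> T" "i \<in> T" "ends G i = {y, z}" by auto
    then show ?case by (intro exI[of _ "w @ [(i, z)]"]) (auto simp: walk_snoc)
  qed
  with that show thesis by blast
qed

lemma linked_refl: "linked G T x x"
  by (simp add: linked_def)

lemma linked_trans: "linked G T x y \<Longrightarrow> linked G T y z \<Longrightarrow> linked G T x z"
  by (simp add: linked_def)

lemma linked_step: "i \<in> T \<Longrightarrow> ends G i = {x, y} \<Longrightarrow> linked G T x y"
  unfolding linked_def by (intro r_into_rtrancl) auto

lemma linked_sym: "linked G T x y \<Longrightarrow> linked G T y x"
proof -
  have "sym {(a, b). \<exists>i\<in>T. ends G i = {a, b}}"
    by (auto simp: sym_def insert_commute)
  then show "linked G T x y \<Longrightarrow> linked G T y x"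
    unfolding linked_def by (meson sym_rtrancl symD)
qed

text \<open>Linkedness in \<open>T\<close> is reflexive and transitive, so it suffices to check
  single incidences of \<open>S\<close>.\<close>

lemma linked_closed:
  assumes "linked G S x y" "\<And>i a b. i \<in> S \<Longrightarrow> ends G i = {a, b} \<Longrightarrow> linked G T a b"
  shows "linked G T x y"
  using assms(1) unfolding linked_def[of G S]
proof (induction rule: rtrancl_induct)
  case base
  show ?case by (rule linked_refl)
next
  case (step y z)
  then show ?case using assms(2) linked_trans by blast
qed

lemma ends_in_nodes:
  assumes "oriented_hypergraph G" "i \<in> incs G" "ends G i = {x, y}"
  shows "x \<in> nodes G" "y \<in> nodes G"
proof -
  have "inc G i \<in> verts G \<times> edges G"
    using assms by (auto simp: oriented_hypergraph_def)
  then have "ends G i \<subseteq> nodes G" by (auto simp: ends_def nodes_def)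
  then show "x \<in> nodes G" "y \<in> nodes G" using assms by auto
qed

lemma ends_neq: "ends G i \<noteq> {x, x}"
  by (auto simp: ends_def)

section \<open>From closed walks to circles\<close>

lemma prod_list_signs:
  fixes f :: "'a \<Rightarrow> int"
  assumes "\<And>x. x \<in> set xs \<Longrightarrow> f x \<in> {1, -1}"
  shows "prod_list (map f xs) \<in> {1, -1}"
  using assms by (induction xs) fastforce+

text \<open>As the nodes are distinct, an incidence used twice would make two positions cyclic
  successors of each other, which a length above 2 rules out.\<close>

lemma circle_of_distinct_walk:
  assumes w: "walk G x w x" "fst ` set w \<subseteq> incs G" "distinct (map snd w)" "length w > 2"
  shows "circle G (x # butlast (map snd w)) (map fst w)"
proof -
  define n where "n = length w"
  define t where "t = map snd w"
  \<comment> \<open>\<open>t\<close> lists the nodes entered and ends in \<open>x\<close>; moving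
    \<open>x\<close> to the front lists the nodes left.\<close>
  define xs where "xs = x # butlast t"
  have n: "n > 2" "length t = n" "length xs = n" "t \<noteq> []"
    using w by (auto simp: n_def t_def xs_def)
  have "last t = x"
    using walk_last[OF w(1)] n by (auto simp: t_def)
  then have t: "t = butlast t @ [x]"
    using n append_butlast_last_id by metis
  have "distinct (butlast t @ [x])"
    by (subst t[symmetric]) (use w(3) in \<open>simp add: t_def\<close>)
  then have dxs: "distinct xs" by (simp add: xs_def)
  have ends: "ends G (map fst w ! k) = {xs ! k, xs ! (Suc k mod n)}" if "k < n" for k
  proof -
    have "xs ! k = (x # t) ! k"
      using that n by (cases k) (auto simp: xs_def nth_butlast)
    moreover have "xs ! (Suc k mod n) = t ! k"
    proof (cases "Suc k = n")
      case True
      then have "t ! k = last t" using n by (auto simp: last_conv_nth)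
      then show ?thesis using True \<open>last t = x\<close> by (simp add: xs_def)
    next
      case False
      then show ?thesis using that n by (simp add: xs_def nth_butlast)
    qed
    ultimately show ?thesis
      using walk_nth[OF w(1), of k] that by (simp add: n_def t_def)
  qed
  have "distinct (map fst w)"
    unfolding distinct_conv_nth
  proof (intro allI impI notI)
    fix a b assume ab: "a < length (map fst w)" "b < length (map fst w)" "a \<noteq> b"
      "map fst w ! a = map fst w ! b"
    then have ab': "a < n" "b < n" by (auto simp: n_def)
    have "{xs ! a, xs ! (Suc a mod n)} = {xs ! b, xs ! (Suc b mod n)}"
      using ends ab ab' by metis
    moreover have "xs ! a \<noteq> xs ! b"
      using dxs ab ab' n by (simp add: nth_eq_iff_index_eq)
    ultimately have "xs ! a = xs ! (Suc b mod n)" "xs ! b = xs ! (Suc a mod n)"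
      by (auto simp: doubleton_eq_iff)
    then have eq: "a = Suc b mod n" "b = Suc a mod n"
      using dxs ab' n(3) by (metis mod_less_divisor nth_eq_iff_index_eq gr_zeroI not_less0)+
    have succ: "Suc k mod n = Suc k \<or> Suc k = n \<and> Suc k mod n = 0" if "k < n" for k
      using that by (cases "Suc k = n") auto
    show False
      using succ[OF ab'(1)] succ[OF ab'(2)] n(1) unfolding eq[symmetric] by linarith
  qed
  then show ?thesis
    using ends n w dxs unfolding circle_def xs_def t_def n_def by auto
qed

text \<open>A shortest closed walk with a nontrivial sign is a circle.\<close>

lemma closed_walk_circle:
  fixes G :: "('v, 'e, 'i) ohgraph" and c :: "'i \<Rightarrow> int"
  assumes "walk G x w x" "fst ` set w \<subseteq> S" "S \<subseteq> incs G"
    and c: "\<And>i. i \<in> S \<Longrightarrow> c i \<in> {1, -1}"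
    and "prod_list (map (c \<circ> fst) w) \<noteq> 1"
  shows "\<exists>xs js. circle G xs js \<and> set js \<subseteq> S \<and> prod_list (map c js) \<noteq> 1"
  using assms(1,2,5)
proof (induction "length w" arbitrary: w x rule: less_induct)
  case less
  show ?case
  proof (cases "distinct (map snd w)")
    case False
    \<comment> \<open>Cutting at two visits to \<open>z\<close> gives two shorter closed walks whose
      products multiply to that of \<open>w\<close>, so one of them is nontrivial.\<close>
    then obtain as bs cs z where decomp: "map snd w = as @ z # (bs @ z # cs)"
      using not_distinct_decomp by fastforce
    have split: "\<exists>w1 i w2. w = w1 @ (i, z) # w2 \<and> map snd w2 = bs"
      if "map snd w = as @ z # bs" for w :: "('i \<times> ('v + 'e)) list" and as bs
      using that unfolding map_eq_append_conv map_eq_Cons_conv by fastforce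
    obtain w1 i r where "w = w1 @ (i, z) # r" "map snd r = bs @ z # cs"
      using split[OF decomp] by blast
    moreover from this obtain w2 j w3 where "r = w2 @ (j, z) # w3"
      using split by blast
    ultimately have w: "w = (w1 @ [(i, z)]) @ (w2 @ [(j, z)]) @ w3" by simp
    have walks: "walk G x ((w1 @ [(i, z)]) @ w3) x" "walk G z (w2 @ [(j, z)]) z"
      using less.prems(1) unfolding w by (auto simp: walk_append)
    have "prod_list (map (c \<circ> fst) ((w1 @ [(i, z)]) @ w3)) \<noteq> 1 \<or>
        prod_list (map (c \<circ> fst) (w2 @ [(j, z)])) \<noteq> 1"
    proof -
      have "prod_list (map (c \<circ> fst) w) =
          prod_list (map (c \<circ> fst) ((w1 @ [(i, z)]) @ w3)) * prod_list (map (c \<circ> fst) (w2 @ [(j, z)]))"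
        unfolding w by (simp add: mult_ac)
      then show ?thesis using less.prems(3) by auto
    qed
    then show ?thesis
    proof
      assume "prod_list (map (c \<circ> fst) ((w1 @ [(i, z)]) @ w3)) \<noteq> 1"
      then show ?thesis by (rule less.hyps[OF _ walks(1), rotated 2]) (use less.prems(2) in \<open>auto simp: w\<close>)
    next
      assume "prod_list (map (c \<circ> fst) (w2 @ [(j, z)])) \<noteq> 1"
      then show ?thesis by (rule less.hyps[OF _ walks(2), rotated 2]) (use less.prems(2) in \<open>auto simp: w\<close>)
    qed
  next
    case dist: True
    consider "w = []" | s where "w = [s]" | s t where "w = [s, t]" | "length w > 2"
    \<comment> \<open>\<open>remdups_adj.cases\<close> serves only to split lists into length zero,
      one, and at least two.\<close>
    proof (cases w rule: remdups_adj.cases)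
      case (3 s t v)
      then show ?thesis using that(3,4) by (cases v) auto
    qed (use that in auto)
    then show ?thesis
    proof cases
      case 1
      then show ?thesis using less.prems by simp
    next
      case (2 s)
      then show ?thesis using less.prems ends_neq[of G] by (cases s) force
    next
      case (3 s t)
      obtain i y j where st: "s = (i, y)" "t = (j, x)" "ends G i = {x, y}" "ends G j = {y, x}"
        using less.prems(1) 3 by (cases s; cases t) auto
      \<comment> \<open>Going back and forth along one incidence would give the trivial product
        \<open>c i * c i\<close>.\<close>
      have "i \<noteq> j"
        using less.prems(2,3) 3 st c[of i] by auto
      moreover have "x \<noteq> y" using st ends_neq by metis
      ultimately have "circle G [x, y] [i, j]"
        using st less.prems(2) 3 assms(3) by (auto simp: circle_def less_Suc_eq nth_Cons')
      then show ?thesis using less.prems 3 st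
        by (intro exI[of _ "[x, y]"] exI[of _ "[i, j]"]) auto
    next
      case 4
      then show ?thesis
        using circle_of_distinct_walk[OF less.prems(1) _ dist 4] less.prems assms(3)
        by (intro exI[of _ "x # butlast (map snd w)"] exI[of _ "map fst w"]) auto
    qed
  qed
qed

section \<open>Switching by signs on the nodes\<close>

text \<open>The multiplicative coboundary of \<open>p\<close>, as in the switching of signed
  graphs.\<close>

definition switching :: "('v, 'e, 'i) ohgraph \<Rightarrow> ('v + 'e \<Rightarrow> int) \<Rightarrow> 'i \<Rightarrow> int" where
  "switching G p i = p (Inl (fst (inc G i))) * p (Inr (snd (inc G i)))"

lemma switching_ends: "ends G i = {x, y} \<Longrightarrow> switching G p i = p x * p y"
  by (auto simp: switching_def ends_def doubleton_eq_iff)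

lemma switching_sign:
  assumes "\<And>x. p x \<in> {1, -1}"
  shows "switching G p i \<in> {1, -1}"
  using assms[of "Inl (fst (inc G i))"] assms[of "Inr (snd (inc G i))"]
  by (auto simp: switching_def)

lemma prod_list_map_mult:
  fixes f g :: "'a \<Rightarrow> int"
  shows "prod_list (map (\<lambda>x. f x * g x) xs) = prod_list (map f xs) * prod_list (map g xs)"
  by (induction xs) auto

lemma circle_switching:
  assumes "circle G xs js" and p: "\<And>x. p x \<in> {1, -1}"
  shows "prod_list (map (switching G p) js) = 1"
proof -
  have *: "prod_list (map2 (\<lambda>x y. p x * p y) xs ys) = prod_list (map p xs) * prod_list (map p ys)"
    if "length ys = length xs" for ys
    using that[symmetric] by (induction xs ys rule: list_induct2) auto
  \<comment> \<open>\<open>rotate1 xs\<close> lists the cyclic successors, and rotation keeps the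
    product, so the whole is the square of a sign.\<close>
  have "map (switching G p) js = map2 (\<lambda>x y. p x * p y) xs (rotate1 xs)"
    using assms(1) by (intro nth_equalityI) (auto simp: circle_def switching_ends nth_rotate1)
  moreover have "prod_list (map p (rotate1 xs)) = prod_list (map p xs)"
    by (cases xs) auto
  moreover have "prod_list (map p xs) \<in> {1, -1}"
    using p by (rule prod_list_signs)
  ultimately show ?thesis by (auto simp: *)
qed

lemma circle_sign_mult:
  "circle_sign (\<lambda>i. s i * t i) js = circle_sign s js * prod_list (map t js)"
  by (simp add: circle_sign_def prod_list_map_mult)

lemma circle_sign_cong:
  "(\<And>i. i \<in> set js \<Longrightarrow> s i = t i) \<Longrightarrow> circle_sign s js = circle_sign t js"
  by (simp add: circle_sign_def cong: map_cong)

lemma circle_orient: "circle (G\<lparr>orient := s\<rparr>) = circle G"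
  by (simp add: circle_def ends_def fun_eq_iff)

lemma balanced_orient:
  "balanced (G\<lparr>orient := s\<rparr>) \<longleftrightarrow> (\<forall>xs js. circle G xs js \<longrightarrow> circle_sign s js = 1)"
  by (simp add: balanced_def circle_orient)

text \<open>Orientations are total functions, but circles see only their values on
  \<open>incs G\<close>.\<close>

lemma balanced_orient_cong:
  assumes "\<And>i. i \<in> incs G \<Longrightarrow> s i = t i"
  shows "balanced (G\<lparr>orient := s\<rparr>) \<longleftrightarrow> balanced (G\<lparr>orient := t\<rparr>)"
proof -
  have "circle_sign s js = circle_sign t js" if "circle G xs js" for xs js
    using that assms by (intro circle_sign_cong) (auto simp: circle_def)
  then show ?thesis by (auto simp: balanced_orient)
qed

lemma balanced_switching:
  assumes "balanced (G\<lparr>orient := s\<rparr>)" "\<And>x. p x \<in> {1, -1}"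
  shows "balanced (G\<lparr>orient := \<lambda>i. s i * switching G p i\<rparr>)"
  using assms circle_switching[of G _ _ p] by (simp add: balanced_orient circle_sign_mult)

section \<open>Potentials on circle-free sets\<close>

text \<open>\<open>p x\<close> is the product of \<open>c\<close> along a walk in \<open>T\<close>
  from a root of the component to \<open>x\<close>. For \<open>i\<close> in \<open>T\<close>, the
  walk to one end, then \<open>i\<close>, then the walk back from the other end form a closed walk;
  its product is 1 as \<open>T\<close> has no circle.\<close>

lemma circle_free_potential:
  fixes G :: "('v, 'e, 'i) ohgraph" and c :: "'i \<Rightarrow> int"
  assumes T: "T \<subseteq> incs G" "circle_free G T" and c: "\<And>i. i \<in> T \<Longrightarrow> c i \<in> {1, -1}"
  obtains p where "\<And>x. p x \<in> {1, -1}" "\<And>i. i \<in> T \<Longrightarrow> switching G p i = c i"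
proof -
  \<comment> \<open>The choice depends only on which nodes are linked to \<open>x\<close>, so linked
    nodes share their root.\<close>
  define root where "root x = (SOME r. linked G T r x)" for x
  have root: "linked G T (root x) x" for x
    unfolding root_def by (rule someI[of _ x]) (rule linked_refl)
  have root_eq: "root x = root y" if "linked G T x y" for x y
  proof -
    have "linked G T r x \<longleftrightarrow> linked G T r y" for r
      using that linked_trans[of G T] linked_sym[of G T] by blast
    then show ?thesis by (simp add: root_def)
  qed
  have "\<forall>x. \<exists>w. walk G (root x) w x \<and> fst ` set w \<subseteq> T"
    using linkedE_walk[OF root] by blast
  then obtain W where W: "\<And>x. walk G (root x) (W x) x" "\<And>x. fst ` set (W x) \<subseteq> T" by metis
  define p where "p x = prod_list (map (c \<circ> fst) (W x))" for x
  have p: "p x \<in> {1, -1}" for x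
    unfolding p_def by (rule prod_list_signs) (use W(2)[of x] c in auto)
  moreover have "switching G p i = c i" if "i \<in> T" for i
  proof -
    define x y :: "'v + 'e" where "x = Inl (fst (inc G i))" and "y = Inr (snd (inc G i))"
    have e: "ends G i = {x, y}" by (simp add: ends_def x_def y_def)
    then have r: "root y = root x" using root_eq that linked_step by metis
    obtain v where v: "walk G y v (root y)" "fst ` set v = fst ` set (W y)"
      "prod_list (map (c \<circ> fst) v) = prod_list (map (c \<circ> fst) (W y))"
      using walk_rev[OF W(1)[of y], of c] by blast
    have "walk G (root x) (W x @ (i, y) # v) (root x)"
      using W(1)[of x] v e r by (auto simp: walk_append)
    moreover have "fst ` set (W x @ (i, y) # v) \<subseteq> T"
      using W(2)[of x] W(2)[of y] that by (simp add: v(2) image_Un)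
    ultimately have "prod_list (map (c \<circ> fst) (W x @ (i, y) # v)) = 1"
      using closed_walk_circle[of G "root x" "W x @ (i, y) # v" T c] T c
      unfolding circle_free_def by metis
    then have "p x * (c i * p y) = 1" using v(3) by (simp add: p_def)
    then have "p x * p y = c i"
      using p[of x] p[of y] c[OF that] by auto
    then show ?thesis by (simp add: switching_ends[OF e])
  qed
  ultimately show thesis using that by blast
qed

section \<open>Fundamental circles and Camion's orientation\<close>

text \<open>Giving \<open>i\<close> the sign \<open>-1\<close> and \<open>T\<close> the sign \<open>1\<close>, the closed walk through \<open>i\<close> is negative, so
  it yields a negative circle, and this circle must contain \<open>i\<close>.\<close>

lemma fundamental_circle_exists:
  fixes G :: "('v, 'e, 'i) ohgraph"
  assumes "oriented_hypergraph G" "spanning_forest G T" "i \<in> incs G" "i \<notin> T"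
  obtains xs js where "fundamental_circle G T i xs js"
proof -
  define x y :: "'v + 'e" where "x = Inl (fst (inc G i))" and "y = Inr (snd (inc G i))"
  have e: "ends G i = {x, y}" by (simp add: ends_def x_def y_def)
  \<comment> \<open>The incidence \<open>i\<close> links its own ends in \<open>G\<close>, so the
    forest links them too.\<close>
  have "linked G T y x"
    using assms e ends_in_nodes[OF assms(1,3) e] linked_step linked_sym
    unfolding spanning_forest_def by metis
  then obtain w where w: "walk G y w x" "fst ` set w \<subseteq> T" by (rule linkedE_walk)
  define c where "c j = (if j = i then -1 else (1::int))" for j
  have c1: "c j \<in> {1, -1}" for j by (simp add: c_def)
  have "map (c \<circ> fst) w = map (\<lambda>_. 1) w"
    using w(2) assms(4) by (auto simp: c_def)
  then have "prod_list (map (c \<circ> fst) ((i, y) # w)) \<noteq> 1"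
    by (simp add: c_def map_replicate_const)
  moreover have "walk G x ((i, y) # w) x" using w e by simp
  moreover have "fst ` set ((i, y) # w) \<subseteq> insert i T" using w by auto
  moreover have "insert i T \<subseteq> incs G" using assms by (auto simp: spanning_forest_def)
  ultimately obtain xs js where *: "circle G xs js" "set js \<subseteq> insert i T" "prod_list (map c js) \<noteq> 1"
    using closed_walk_circle[of G x "(i, y) # w" "insert i T" c] c1 by blast
  have "i \<in> set js"
  proof (rule ccontr)
    assume "i \<notin> set js"
    then have "map c js = map (\<lambda>_. 1) js" by (auto simp: c_def)
    then show False using *(3) by (simp add: map_replicate_const)
  qed
  with * that show thesis by (auto simp: fundamental_circle_def)
qed

text \<open>By distinctness \<open>i\<close> contributes exactly one factor. Hence at most one sign
  of \<open>i\<close> can make a circle through it positive.\<close>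

lemma circle_sign_upd_uminus:
  assumes "distinct js" "i \<in> set js"
  shows "circle_sign (s(i := - a)) js = - circle_sign (s(i := a)) js"
proof -
  obtain us vs where js: "js = us @ i # vs" "i \<notin> set us" "i \<notin> set vs"
    using split_list[OF assms(2)] assms(1) by auto
  then have "map (s(i := b)) us = map s us" "map (s(i := b)) vs = map s vs" for b
    by auto
  then show ?thesis by (simp add: circle_sign_def js)
qed

text \<open>A fundamental circle lies in \<open>insert i T\<close>, where \<open>s\<close> and
  \<open>(orient G)(i := s i)\<close> agree, so balance of \<open>s\<close> makes \<open>s i\<close>
  admissible. The opposite sign fails on a fundamental circle, which exists, so the
  \<open>THE\<close> is well defined.\<close>

lemma camion_orient_eq:
  assumes "oriented_hypergraph G" "spanning_forest G T"
    and s: "balanced (G\<lparr>orient := s\<rparr>)" "\<And>i. i \<in> incs G \<Longrightarrow> s i \<in> {1, -1}"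
      "\<And>i. i \<in> T \<Longrightarrow> s i = orient G i"
    and i: "i \<in> incs G"
  shows "camion_orient G T i = s i"
proof (cases "i \<in> T")
  case True
  then show ?thesis using s by (simp add: camion_orient_def)
next
  case False
  obtain xs js where js: "fundamental_circle G T i xs js"
    using fundamental_circle_exists[OF assms(1,2) i False] .
  have pos: "circle_sign ((orient G)(i := s i)) js = 1" if "fundamental_circle G T i xs js" for xs js
  proof -
    have "circle_sign ((orient G)(i := s i)) js = circle_sign s js"
      using that s(3) by (intro circle_sign_cong) (auto simp: fundamental_circle_def)
    then show ?thesis using that s(1) by (auto simp: fundamental_circle_def balanced_orient)
  qed
  have "(THE a. a \<in> {1, -1} \<and> (\<forall>xs js. fundamental_circle G T i xs js \<longrightarrow>
           circle_sign ((orient G)(i := a)) js = 1)) = s i"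
  proof (rule the_equality)
    show "s i \<in> {1, -1} \<and> (\<forall>xs js. fundamental_circle G T i xs js \<longrightarrow>
           circle_sign ((orient G)(i := s i)) js = 1)"
      using pos s(2)[OF i] by blast
  next
    fix a :: int
    assume a: "a \<in> {1, -1} \<and> (\<forall>xs js. fundamental_circle G T i xs js \<longrightarrow>
           circle_sign ((orient G)(i := a)) js = 1)"
    show "a = s i"
    proof (rule ccontr)
      assume "a \<noteq> s i"
      then have "a = - s i" using a s(2)[OF i] by auto
      moreover have "distinct js" "i \<in> set js"
        using js by (auto simp: fundamental_circle_def circle_def)
      ultimately have "circle_sign ((orient G)(i := a)) js = - 1"
        using circle_sign_upd_uminus pos[OF js] by metis
      then show False using a js by auto
    qed
  qed
  then show ?thesis using False by (simp add: camion_orient_def)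
qed

section \<open>Balancing sets that avoid a forest\<close>

text \<open>The orientation of \<open>reverse G B\<close> is balanced and unchanged on
  \<open>T\<close>, so \<open>camion_orient_eq\<close> applies to it; signs being nonzero, it
  differs from \<open>orient G\<close> exactly on \<open>B\<close>.\<close>

lemma camion_set_unique:
  assumes G: "oriented_hypergraph G" and T: "spanning_forest G T"
    and B: "balancing_set G B" "B \<inter> T = {}"
  shows "camion_set G T = B"
proof -
  have sgn: "orient G i \<in> {1, -1}" if "i \<in> incs G" for i
    using G that by (auto simp: oriented_hypergraph_def)
  have cam: "camion_orient G T i = (if i \<in> B then - orient G i else orient G i)" if "i \<in> incs G" for i
    by (rule camion_orient_eq[OF G T])
      (use B that sgn in \<open>fastforce simp: balancing_set_def reverse_def\<close>)+
  have "B \<subseteq> incs G" using B(1) by (simp add: balancing_set_def)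
  moreover have "camion_orient G T i \<noteq> orient G i \<longleftrightarrow> i \<in> B" if "i \<in> incs G" for i
    using cam[OF that] sgn[OF that] by auto
  ultimately show ?thesis by (auto simp: camion_set_def)
qed

lemma balancing_set_avoiding_forest:
  assumes "oriented_hypergraph G" "balanceable G" "T \<subseteq> incs G" "circle_free G T"
  obtains B where "balancing_set G B" "B \<inter> T = {}"
proof -
  have sgn: "orient G i \<in> {1, -1}" if "i \<in> incs G" for i
    using assms that by (auto simp: oriented_hypergraph_def)
  obtain s where s: "s ` incs G \<subseteq> {1, -1}" "balanced (G\<lparr>orient := s\<rparr>)"
    using assms by (auto simp: balanceable_def)
  have s1: "s i \<in> {1, -1}" if "i \<in> incs G" for i using s that by auto
  \<comment> \<open>This is the discrepancy between \<open>s\<close> and \<open>orient G\<close>;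
    signs are their own inverses, so switching by it turns \<open>s\<close> into
    \<open>orient G\<close> on \<open>T\<close>.\<close>
  have "s i * orient G i \<in> {1, -1}" if "i \<in> T" for i
    using s1[of i] sgn[of i] that assms(3) by fastforce
  then obtain p where p: "\<And>x. p x \<in> {1, -1}"
    "\<And>i. i \<in> T \<Longrightarrow> switching G p i = s i * orient G i"
    using circle_free_potential[OF assms(3,4), of "\<lambda>i. s i * orient G i"] by blast
  define t where "t i = s i * switching G p i" for i
  have t1: "t i \<in> {1, -1}" if "i \<in> incs G" for i
    using s1[OF that] switching_sign[of p G i] p(1) by (auto simp: t_def)
  define B where "B = {i \<in> incs G. t i \<noteq> orient G i}"
  have bal: "balanced (G\<lparr>orient := t\<rparr>)"
    unfolding t_def using s(2) p(1) by (rule balanced_switching)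
  have eq: "t i = (if i \<in> B then - orient G i else orient G i)" if "i \<in> incs G" for i
    using t1[OF that] sgn[OF that] that by (auto simp: B_def)
  have "balanced (reverse G B)"
    unfolding reverse_def by (rule balanced_orient_cong[THEN iffD1, OF _ bal]) (rule eq)
  moreover have "B \<inter> T = {}"
  proof -
    have "t i = orient G i" if "i \<in> T" for i
      using p(2)[OF that] s1[OF subsetD[OF assms(3) that]] by (auto simp: t_def)
    then show ?thesis by (auto simp: B_def)
  qed
  moreover have "B \<subseteq> incs G" by (simp add: B_def)
  ultimately show thesis using that by (simp add: balancing_set_def)
qed

section \<open>Forests in the complement of a minimal balancing set\<close>

text \<open>Zorn's lemma covers infinite \<open>S\<close>. A maximal circle-free \<open>T\<close>
  links the ends of every \<open>i\<close> in \<open>S\<close>, since otherwise \<open>i\<close>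
  could be added without closing a circle.\<close>

lemma maximal_circle_free:
  fixes G :: "('v, 'e, 'i) ohgraph"
  assumes "S \<subseteq> incs G"
  obtains T where "T \<subseteq> S" "circle_free G T"
    "\<And>x y. linked G S x y \<Longrightarrow> linked G T x y"
proof -
  have "\<exists>M\<in>{T. T \<subseteq> S \<and> circle_free G T}. \<forall>X\<in>{T. T \<subseteq> S \<and> circle_free G T}. M \<subseteq> X \<longrightarrow> X = M"
  proof (rule subset_Zorn_nonempty)
    show "{T. T \<subseteq> S \<and> circle_free G T} \<noteq> {}"
      by (auto simp: circle_free_def circle_def intro!: exI[of _ "{}"])
  next
    fix C assume C: "C \<noteq> {}" "subset.chain {T. T \<subseteq> S \<and> circle_free G T} C"
    have "circle_free G (\<Union>C)"
      unfolding circle_free_def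
    proof (intro notI, elim exE conjE)
      fix xs js assume js: "circle G xs js" "set js \<subseteq> \<Union>C"
      \<comment> \<open>A circle has finitely many incidences, so one member of the chain contains
        them all.\<close>
      obtain T where "T \<in> C" "set js \<subseteq> T"
        using finite_subset_Union_chain[OF _ js(2) C(1), of "{T. T \<subseteq> S \<and> circle_free G T}"] C(2)
        by auto
      then show False using C(2) js(1) by (auto simp: subset_chain_def circle_free_def)
    qed
    then show "\<Union>C \<in> {T. T \<subseteq> S \<and> circle_free G T}"
      using C(2) by (auto simp: subset_chain_def)
  qed
  then obtain T where T: "T \<subseteq> S" "circle_free G T"
    and max: "\<And>X. X \<subseteq> S \<Longrightarrow> circle_free G X \<Longrightarrow> T \<subseteq> X \<Longrightarrow> X = T" by auto
  have "linked G T a b" if i: "i \<in> S" "ends G i = {a, b}" for i a b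
  proof (rule ccontr)
    assume nl: "\<not> linked G T a b"
    then have "i \<notin> T" using i linked_step by metis
    then have "\<not> circle_free G (insert i T)" using max[of "insert i T"] T(1) i(1) by auto
    then obtain xs js where js: "circle G xs js" "set js \<subseteq> insert i T"
      by (auto simp: circle_free_def)
    then have "i \<in> set js" using T(2) by (auto simp: circle_free_def)
    \<comment> \<open>The circle would cross the cut around the component of \<open>a\<close> in \<open>T\<close> only once, at \<open>i\<close>.\<close>
    define p where "p x = (if linked G T a x then -1 else (1::int))" for x
    have "switching G p j = 1" if "j \<in> T" for j
    proof -
      define u v :: "'v + 'e" where "u = Inl (fst (inc G j))" and "v = Inr (snd (inc G j))"
      have e: "ends G j = {u, v}" by (simp add: ends_def u_def v_def)
      then have "linked G T u v" using that by (intro linked_step)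
      then have "linked G T a u \<longleftrightarrow> linked G T a v"
        using linked_trans[of G T] linked_sym[of G T] by blast
      then show ?thesis by (simp add: switching_ends[OF e] p_def)
    qed
    \<comment> \<open>On this circle, switching the all-positive orientation changes the sign of
      \<open>i\<close> only. So it negates the sign of the circle, yet switching preserves
      it.\<close>
    then have "circle_sign (\<lambda>j. 1 * switching G p j) js = circle_sign ((\<lambda>j. 1)(i := - 1)) js"
      using js(2) nl linked_refl[of G T a]
      by (intro circle_sign_cong) (auto simp: switching_ends[OF i(2)] p_def)
    also have "\<dots> = - circle_sign ((\<lambda>j. 1)(i := 1)) js"
      using js(1) \<open>i \<in> set js\<close> by (intro circle_sign_upd_uminus) (auto simp: circle_def)
    also have "(\<lambda>j. 1)(i := 1) = (\<lambda>j. 1 :: int)" by auto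
    finally have "circle_sign (\<lambda>j. 1) js * prod_list (map (switching G p) js) = - circle_sign (\<lambda>j. 1) js"
      unfolding circle_sign_mult .
    moreover have "prod_list (map (switching G p) js) = 1"
      by (rule circle_switching[OF js(1)]) (simp add: p_def)
    ultimately have "circle_sign (\<lambda>j. 1) js = 0" by simp
    then show False by (simp add: circle_sign_def map_replicate_const)
  qed
  then have "linked G T x y" if "linked G S x y" for x y
    using linked_closed[OF that, of T] by blast
  with T that show thesis by blast
qed

text \<open>If the ends \<open>a\<close>, \<open>b\<close> of an incidence \<open>i\<close> are not
  linked outside \<open>B\<close>, the cut \<open>D\<close> around the component of \<open>a\<close>
  lies in \<open>B\<close> and contains \<open>i\<close>. Switching along the cut shows that
  \<open>B - D\<close> is still balancing, against minimality.\<close>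

lemma minimal_balancing_set_linked:
  fixes G :: "('v, 'e, 'i) ohgraph"
  assumes min: "minimal_balancing_set G B" and "linked G (incs G) x y"
  shows "linked G (incs G - B) x y"
proof (rule linked_closed[OF assms(2)], rule ccontr)
  fix i a b assume i: "i \<in> incs G" "ends G i = {a, b}" and nl: "\<not> linked G (incs G - B) a b"
  define p where "p x = (if linked G (incs G - B) a x then -1 else (1::int))" for x
  define D where "D = {j \<in> incs G. switching G p j = -1}"
  have B: "B \<subseteq> incs G" "balanced (reverse G B)"
    using min unfolding minimal_balancing_set_def balancing_set_def by blast+
  have p1: "p x \<in> {1, -1}" for x by (simp add: p_def)
  have "switching G p j = 1" if "j \<in> incs G - B" for j
  proof -
    define u v :: "'v + 'e" where "u = Inl (fst (inc G j))" and "v = Inr (snd (inc G j))"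
    have e: "ends G j = {u, v}" by (simp add: ends_def u_def v_def)
    then have "linked G (incs G - B) u v" using that by (intro linked_step)
    then have "linked G (incs G - B) a u \<longleftrightarrow> linked G (incs G - B) a v"
      using linked_trans[of G "incs G - B"] linked_sym[of G "incs G - B"] by blast
    then show ?thesis by (simp add: switching_ends[OF e] p_def)
  qed
  then have "switching G p j \<noteq> -1" if "j \<in> incs G - B" for j
    using that by simp
  then have DB: "D \<subseteq> B" unfolding D_def by blast
  have "i \<in> D"
    using i(1) nl linked_refl[of G _ a] by (simp add: D_def switching_ends[OF i(2)] p_def)
  have bal: "balanced (G\<lparr>orient := \<lambda>j. (if j \<in> B then - orient G j else orient G j) * switching G p j\<rparr>)"
    using B(2) p1 unfolding reverse_def by (rule balanced_switching)
  \<comment> \<open>On \<open>D\<close> the reversal and the switching cancel; elsewhere in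
    \<open>incs G\<close> the switching is 1.\<close>
  have eq: "(if j \<in> B then - orient G j else orient G j) * switching G p j =
      (if j \<in> B - D then - orient G j else orient G j)" if "j \<in> incs G" for j
    using that DB switching_sign[of p G j, OF p1] by (auto simp: D_def)
  have "balanced (reverse G (B - D))"
    unfolding reverse_def by (rule balanced_orient_cong[THEN iffD1, OF _ bal]) (rule eq)
  then have "balancing_set G (B - D)" using B(1) by (auto simp: balancing_set_def)
  moreover have "B - D \<subset> B" using \<open>i \<in> D\<close> DB by blast
  ultimately show False using min unfolding minimal_balancing_set_def by blast
qed

theorem lemma3p1p5:
  fixes G :: "('v, 'e, 'i) ohgraph" and B :: "'i set"
  assumes "oriented_hypergraph G"
    and "balanceable G"
  shows "minimal_balancing_set G B \<longleftrightarrow> (\<exists>T. spanning_forest G T \<and> B = camion_set G T)"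
proof
  assume min: "minimal_balancing_set G B"
  then have B: "balancing_set G B" by (simp add: minimal_balancing_set_def)
  obtain T where T: "T \<subseteq> incs G - B" "circle_free G T"
    "\<And>x y. linked G (incs G - B) x y \<Longrightarrow> linked G T x y"
    using maximal_circle_free[OF Diff_subset, of G B] by blast
  \<comment> \<open>Nodes linked in \<open>G\<close> stay linked outside \<open>B\<close> by
    minimality, and then in \<open>T\<close> by its choice.\<close>
  have forest: "spanning_forest G T"
    unfolding spanning_forest_def
    using T(1,2) T(3)[OF minimal_balancing_set_linked[OF min]] by blast
  have "B \<inter> T = {}" using T(1) by blast
  then have "B = camion_set G T"
    by (rule camion_set_unique[OF assms(1) forest B, symmetric])
  with forest show "\<exists>T. spanning_forest G T \<and> B = camion_set G T" by blast
next
  assume "\<exists>T. spanning_forest G T \<and> B = camion_set G T"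
  then obtain T where T: "spanning_forest G T" "B = camion_set G T" by blast
  then have "T \<subseteq> incs G" "circle_free G T" by (simp_all add: spanning_forest_def)
  then obtain B0 where B0: "balancing_set G B0" "B0 \<inter> T = {}"
    by (rule balancing_set_avoiding_forest[OF assms])
  have "B = B0"
    unfolding T(2) by (rule camion_set_unique[OF assms(1) T(1) B0])
  with B0 have B: "balancing_set G B" "B \<inter> T = {}" by simp_all
  have "\<not> balancing_set G B'" if "B' \<subset> B" for B'
  proof
    assume "balancing_set G B'"
    \<comment> \<open>A smaller balancing set also avoids \<open>T\<close>, so uniqueness forces it
      to equal \<open>B\<close>.\<close>
    moreover have "B' \<inter> T = {}" using that B(2) by blast
    ultimately have "B = B'"
      unfolding T(2) by (rule camion_set_unique[OF assms(1) T(1)])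
    with that show False by blast
  qed
  with B(1) show "minimal_balancing_set G B" by (simp add: minimal_balancing_set_def)
qed

end
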